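(* Let $D \subset \ell^\infty$ be a finite-dimensional subspace with $D \cap c = \{0\}$. For any separable Banach space $E$, there exists a closed subspace $Z \subset \ell^\infty$ containing $D$ and containing a subspace isometric to $E$, such that $Z \cap c = \{0\}$.
   Context: The scalar field is $\mathbb{K}=\mathbb{R}$ or $\mathbb{C}$. $\ell^\infty$ is the Banach space of all bounded $\mathbb{K}$-valued sequences $(x_n)_{n=1}^\infty$ with the sup norm $\|\cdot\|_\infty$, and $c\subset\ell^\infty$ is the subspace of convergent sequences. Subspace means linear subspace. A subspace $Y\subset\ell^\infty$ is "isometric to $E$" if there is a linear map $T:E\to\ell^\infty$ with $\|T(x)\|_\infty=\|x\|$ for all $x\in E$ and $T(E)=Y$. *)

theory Defs
  imports "HOL-Analysis.Analysis"
begin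

text \<open>
  Since \<open>nat\<close> carries the discrete topology, \<^typ>\<open>nat \<Rightarrow>\<^sub>C 'k\<close> is the space of all bounded sequences
  in \<open>'k\<close>, with the sup norm; sequences are indexed from 0.
  The scalar field \<open>'k\<close> is instantiated to \<^typ>\<open>real\<close> and to \<^typ>\<open>complex\<close>.
\<close>

type_synonym 'k linf = "nat \<Rightarrow>\<^sub>C 'k"

lemma linf_norm_eq_SUP: "norm (x :: 'k::real_normed_field linf) = (SUP n. norm (apply_bcontfun x n))"
  unfolding norm_bcontfun_def dist_bcontfun.rep_eq by simp

lemma range_linf:
  "range (apply_bcontfun :: 'k::real_normed_field linf \<Rightarrow> nat \<Rightarrow> 'k) = {f. bounded (range f)}"
proof -
  have "f \<in> range (apply_bcontfun :: 'k linf \<Rightarrow> _)" if "bounded (range f)" for f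
    using that bcontfunE[of f] by (auto simp: bcontfun_def)
  then show ?thesis by auto
qed

definition linf_scale :: "'k::real_normed_field \<Rightarrow> 'k linf \<Rightarrow> 'k linf" where
  "linf_scale a x = Bcontfun (\<lambda>n. a * apply_bcontfun x n)"

lemma apply_linf_scale [simp]: "apply_bcontfun (linf_scale a x) n = a * apply_bcontfun x n"
proof -
  have "(\<lambda>n. a * apply_bcontfun x n) \<in> bcontfun"
    by (rule bcontfun_normI[where b = "norm a * norm x"])
       (auto intro!: continuous_intros mult_left_mono norm_bounded simp: norm_mult)
  then show ?thesis
    by (simp add: linf_scale_def Bcontfun_inverse)
qed

interpretation linf: vector_space "linf_scale :: 'k::real_normed_field \<Rightarrow> 'k linf \<Rightarrow> 'k linf"
  by standard (auto intro!: bcontfun_eqI simp: algebra_simps)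

lemma linf_scale_real: "(linf_scale :: real \<Rightarrow> real linf \<Rightarrow> real linf) = scaleR"
  by (intro ext bcontfun_eqI) simp

definition c_space :: "'k::real_normed_field linf set" where
  "c_space = {x. convergent (apply_bcontfun x)}"

definition finite_dim_subspace :: "'k::real_normed_field linf set \<Rightarrow> bool" where
  "finite_dim_subspace D \<longleftrightarrow> (\<exists>B. finite B \<and> D = linf.span B)"

text \<open>
  A Banach space over \<open>'k\<close> is a type of class \<^class>\<open>banach\<close> (which supplies addition and a complete norm)
  with a multiplication by scalars from \<open>'k\<close> for which the norm is homogeneous. Compatibility
  with \<^const>\<open>scaleR\<close> need not be required; see \<open>banach_over_of_real\<close>.
\<close>

definition banach_over :: "('k::real_normed_field \<Rightarrow> 'e::banach \<Rightarrow> 'e) \<Rightarrow> bool" where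
  "banach_over s \<longleftrightarrow> vector_space s \<and> (\<forall>a x. norm (s a x) = norm a * norm x)"

lemma banach_over_scaleR: "banach_over (scaleR :: real \<Rightarrow> 'e::banach \<Rightarrow> 'e)"
  unfolding banach_over_def by (auto intro: real_vector.vector_space_axioms)

lemma banach_over_of_real:
  assumes "banach_over s"
  shows "s (of_real r) x = r *\<^sub>R x"
proof -
  interpret vector_space s using assms by (simp add: banach_over_def)
  have nrm: "norm (s a y) = norm a * norm y" for a y
    using assms by (simp add: banach_over_def)
  have nat: "s (of_nat n) y = real n *\<^sub>R y" for n y
    by (induction n) (simp_all add: scale_left_distrib scaleR_left_distrib)
  have int: "s (of_int k) y = real_of_int k *\<^sub>R y" for k y
    by (cases k rule: int_cases2) (simp_all add: nat)
  have rat: "s (of_real q) x = q *\<^sub>R x" if qrat: "q \<in> \<rat>" for q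
  proof -
    obtain a b where q: "q = real_of_int a / real_of_int b" and b: "b \<noteq> 0"
      using qrat by (auto simp: Rats_eq_int_div_int)
    have "real_of_int b *\<^sub>R s (of_real q) x = s (of_int b * of_real q) x"
      by (simp flip: int)
    also have "(of_int b :: 'a) * of_real q = of_int a"
      using b by (simp add: q)
    finally have "real_of_int b *\<^sub>R s (of_real q) x = real_of_int b *\<^sub>R (q *\<^sub>R x)"
      using b by (simp add: int q)
    then show ?thesis using b by (simp only: scaleR_cancel_left of_int_eq_0_iff simp_thms)
  qed
  have bl: "norm (s (of_real t) x - t *\<^sub>R x) \<le> 2 * \<bar>t\<bar> * norm x" for t
    using norm_triangle_ineq4[of "s (of_real t) x" "t *\<^sub>R x"] by (simp add: nrm)
  have "norm (s (of_real r) x - r *\<^sub>R x) \<le> e" if "e > 0" for e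
  proof -
    define d where "d = e / (2 * (norm x + 1))"
    have d: "d > 0" "2 * d * norm x \<le> e"
      using that by (auto simp: d_def field_simps add_pos_nonneg)
    obtain q where q: "q \<in> \<rat>" "r - d < q" "q < r"
      using Rats_dense_in_real[of "r - d" r] d by auto
    have "s (of_real r) x - r *\<^sub>R x = s (of_real (r - q)) x - (r - q) *\<^sub>R x"
      using rat[OF q(1)] by (simp add: scale_left_diff_distrib scaleR_left_diff_distrib)
    also have "norm \<dots> \<le> 2 * \<bar>r - q\<bar> * norm x"
      by (rule bl)
    also have "\<dots> \<le> 2 * d * norm x"
      using q by (intro mult_right_mono) auto
    finally show ?thesis using d by simp
  qed
  from this[of "norm (s (of_real r) x - r *\<^sub>R x) / 2"]
  have "\<not> 0 < norm (s (of_real r) x - r *\<^sub>R x)" by linarith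
  then show ?thesis by simp
qed

definition isometric_to :: "'k linf set \<Rightarrow> ('k::real_normed_field \<Rightarrow> 'e::banach \<Rightarrow> 'e) \<Rightarrow> bool" where
  "isometric_to Y s \<longleftrightarrow>
    (\<exists>T. Vector_Spaces.linear s linf_scale T \<and> (\<forall>x. norm (T x) = norm x) \<and> range T = Y)"

end

theory Submission
  imports Defs
begin

text \<open>
  By induction on a spanning set, there is a co-infinite set \<open>A\<close> of indices along which no nonzero
  \<open>d \<in> D\<close> converges: if some \<open>d\<close> becomes convergent along \<open>A\<close>, it is unique up to a scalar, and
  infinitely many indices where \<open>d\<close> stays away from its limit can be added to \<open>A\<close>.
  Embed \<open>E\<close> by sequences that vanish on \<open>A\<close> and take each value of a countable norming family of
  functionals infinitely often off \<open>A\<close>. If \<open>d + T x\<close> converges, then \<open>d\<close> converges along \<open>A\<close>, so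
  \<open>d = 0\<close>; then \<open>T x\<close> converges to \<open>0\<close> and every norming functional vanishes at \<open>x\<close>.
  Finally \<open>D + T(E)\<close> is closed, as a finite-dimensional extension of a complete space.
\<close>

section \<open>Hahn-Banach: linear functionals of norm at most one attaining the norm at a
  point\<close>

definition sublinear :: "('a::real_vector \<Rightarrow> real) \<Rightarrow> bool" where
  "sublinear q \<longleftrightarrow> (\<forall>x y. q (x + y) \<le> q x + q y) \<and> (\<forall>t\<ge>0. \<forall>x. q (t *\<^sub>R x) = t * q x)"

lemma sublinear_add: "sublinear q \<Longrightarrow> q (x + y) \<le> q x + q y"
  and sublinear_scaleR: "sublinear q \<Longrightarrow> t \<ge> 0 \<Longrightarrow> q (t *\<^sub>R x) = t * q x"
  by (auto simp: sublinear_def)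

lemma sublinear_zero: "sublinear q \<Longrightarrow> q 0 = 0"
  using sublinear_scaleR[of q 0 0] by simp

lemma sublinear_minus_le: "sublinear q \<Longrightarrow> - q (- x) \<le> q x"
  using sublinear_add[of q x "- x"] by (simp add: sublinear_zero)

text \<open>The scaling bound for \<open>inverse t\<close> at \<open>t *\<^sub>R x\<close> is the
  reverse inequality, so an upper bound suffices. This suits functionals built as infima.\<close>

lemma sublinearI:
  assumes add: "\<And>x y. q (x + y) \<le> q x + q y" and zero: "q 0 = 0"
    and scale: "\<And>t x. t > 0 \<Longrightarrow> q (t *\<^sub>R x) \<le> t * q x"
  shows "sublinear q"
proof -
  have "q (t *\<^sub>R x) = t * q x" if "t \<ge> 0" for t x
  proof (cases "t = 0")
    case False
    then have t: "t > 0" using that by simp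
    have "q x \<le> inverse t * q (t *\<^sub>R x)"
      using scale[of "inverse t" "t *\<^sub>R x"] t by simp
    then have "t * q x \<le> q (t *\<^sub>R x)"
      using t by (simp add: field_simps)
    with scale[OF t, of x] show ?thesis by simp
  qed (simp add: zero)
  with add show ?thesis by (simp add: sublinear_def)
qed

text \<open>
  A minimal sublinear functional equals all its tilts, which forces it to be additive; tilting the
  norm at \<open>a\<close> before minimizing makes the linear minorant attain the norm at \<open>a\<close>.
\<close>

lemma sublinear_tilt:
  assumes q: "sublinear q"
  obtains q' where "sublinear q'" "\<And>x t. t \<ge> 0 \<Longrightarrow> q' x \<le> q (x + t *\<^sub>R y) - t * q y"
proof -
  define g where "g x t = q (x + t *\<^sub>R y) - t * q y" for x t
  define q' where "q' x = (INF t\<in>{0..}. g x t)" for x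
  \<comment> \<open>The bound does not depend on \<open>t\<close>, so the infimum defining
    \<open>q'\<close> is a genuine lower bound.\<close>
  have lower: "- q (- x) \<le> g x t" if "t \<ge> 0" for x t
    using sublinear_add[OF q, of "x + t *\<^sub>R y" "- x"] sublinear_scaleR[OF q that, of y]
    by (simp add: g_def)
  have le: "q' x \<le> g x t" if "t \<ge> 0" for x t
    unfolding q'_def using that lower by (intro cINF_lower bdd_belowI2) auto
  have greatest: "m \<le> q' x" if "\<And>t. t \<ge> 0 \<Longrightarrow> m \<le> g x t" for m x
    unfolding q'_def using that by (intro cINF_greatest) auto
  have "sublinear q'"
  proof (rule sublinearI)
    fix x z
    \<comment> \<open>Parameters add: \<open>s\<close> for \<open>x\<close> and \<open>t\<close> for
      \<open>z\<close> are beaten by \<open>s + t\<close> for \<open>x + z\<close>. Infima over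
      \<open>t\<close> and then over \<open>s\<close> give subadditivity.\<close>
    have "q' (x + z) \<le> g x s + g z t" if "s \<ge> 0" "t \<ge> 0" for s t
    proof -
      have "q' (x + z) \<le> g (x + z) (s + t)"
        using that by (intro le) auto
      also have "\<dots> \<le> g x s + g z t"
        using sublinear_add[OF q, of "x + s *\<^sub>R y" "z + t *\<^sub>R y"]
        by (simp add: g_def algebra_simps)
      finally show ?thesis .
    qed
    then have "q' (x + z) - g x s \<le> q' z" if "s \<ge> 0" for s
      using that by (intro greatest) (simp add: algebra_simps)
    then have "q' (x + z) - q' z \<le> q' x"
      by (intro greatest) (simp add: algebra_simps)
    then show "q' (x + z) \<le> q' x + q' z" by simp
  next
    have "0 \<le> q' 0"
      using lower[of _ 0] by (intro greatest) (simp add: sublinear_zero[OF q])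
    with le[of 0 0] show "q' 0 = 0"
      by (simp add: g_def sublinear_zero[OF q])
  next
    fix r :: real and x assume r: "r > 0"
    have "q' (r *\<^sub>R x) / r \<le> g x t" if t: "t \<ge> 0" for t
    proof -
      have "q' (r *\<^sub>R x) \<le> g (r *\<^sub>R x) (r * t)"
        using r t by (intro le) auto
      also have "\<dots> = r * g x t"
        using sublinear_scaleR[OF q, of r "x + t *\<^sub>R y"] r by (simp add: g_def algebra_simps)
      finally show ?thesis using r by (simp add: field_simps)
    qed
    then have "q' (r *\<^sub>R x) / r \<le> q' x"
      by (rule greatest)
    then show "q' (r *\<^sub>R x) \<le> r * q' x"
      using r by (simp add: field_simps)
  qed
  with le show ?thesis
    by (intro that) (auto simp: g_def)
qed

text \<open>Supplies the bounds for Zorn's lemma: the pointwise infimum is finite because every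
  member is at least \<open>- p (- x)\<close> at \<open>x\<close>. A pointwise infimum need not be
  subadditive in general; for a chain it is, since the smaller of \<open>q\<close> and
  \<open>r\<close> can serve both summands.\<close>

lemma sublinear_Inf_chain:
  assumes C: "C \<noteq> {}" "\<And>q. q \<in> C \<Longrightarrow> sublinear q \<and> q \<le> p"
    and chain: "\<And>q r. q \<in> C \<Longrightarrow> r \<in> C \<Longrightarrow> q \<le> r \<or> r \<le> q"
  obtains u where "sublinear u" "\<And>q. q \<in> C \<Longrightarrow> u \<le> q"
proof -
  define u where "u x = (INF q\<in>C. q x)" for x
  have lower: "- p (- x) \<le> q x" if "q \<in> C" for q x
    using sublinear_minus_le[of q x] C(2)[OF that] le_funD[of q p "- x"] by force
  have le: "u x \<le> q x" if "q \<in> C" for q x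
    unfolding u_def using that lower by (intro cINF_lower bdd_belowI2) auto
  have greatest: "m \<le> u x" if "\<And>q. q \<in> C \<Longrightarrow> m \<le> q x" for m x
    unfolding u_def using that C(1) by (intro cINF_greatest) auto
  have "sublinear u"
  proof (rule sublinearI)
    fix x z
    have le_add: "u (x + z) \<le> q x + r z" if qr: "q \<in> C" "r \<in> C" for q r
    proof -
      obtain w where w: "w \<in> C" "w x \<le> q x" "w z \<le> r z"
        using chain[OF qr] qr by (auto simp: le_fun_def)
      have "u (x + z) \<le> w (x + z)"
        by (rule le[OF w(1)])
      also have "\<dots> \<le> w x + w z"
        using C(2)[OF w(1)] by (simp add: sublinear_add)
      finally show ?thesis using w by simp
    qed
    have "u (x + z) - q x \<le> u z" if "q \<in> C" for q
    proof (rule greatest)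
      show "u (x + z) - q x \<le> r z" if "r \<in> C" for r
        using le_add[OF \<open>q \<in> C\<close> that] by simp
    qed
    then have "u (x + z) - u z \<le> u x"
      by (intro greatest) (simp add: algebra_simps)
    then show "u (x + z) \<le> u x + u z" by simp
  next
    show "u 0 = 0"
      using C by (simp add: u_def sublinear_zero)
  next
    fix t :: real and x assume t: "t > 0"
    have "u (t *\<^sub>R x) / t \<le> u x"
    proof (rule greatest)
      fix q assume "q \<in> C"
      then show "u (t *\<^sub>R x) / t \<le> q x"
        using le[of q "t *\<^sub>R x"] C(2)[of q] t by (simp add: sublinear_scaleR field_simps)
    qed
    then show "u (t *\<^sub>R x) \<le> t * u x"
      using t by (simp add: field_simps)
  qed
  with le show ?thesis
    by (intro that) (auto simp: le_fun_def)
qed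

lemma linear_minorant:
  assumes p: "sublinear p"
  obtains f where "linear f" "\<And>x. f x \<le> p x"
proof -
  define S where "S = {q. sublinear q \<and> q \<le> p}"
  have "\<exists>m\<in>S. \<forall>q\<in>S. q \<le> m \<longrightarrow> q = m"
  \<comment> \<open>The order is reversed, so the maximal element found is a minimal sublinear
    functional below \<open>p\<close>.\<close>
  proof (rule predicate_Zorn[of S "\<lambda>q r. r \<le> q"])
    show "partial_order_on S (relation_of (\<lambda>q r. r \<le> q) S)"
      by (rule partial_order_on_relation_ofI) auto
  next
    fix C assume "C \<in> Chains (relation_of (\<lambda>q r. r \<le> q) S)"
    then have C: "C \<subseteq> S" "\<And>q r. q \<in> C \<Longrightarrow> r \<in> C \<Longrightarrow> q \<le> r \<or> r \<le> q"
      by (auto simp: Chains_def relation_of_def)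
    show "\<exists>u\<in>S. \<forall>q\<in>C. u \<le> q"
    proof (cases "C = {}")
      case True
      then show ?thesis using p by (auto simp: S_def)
    next
      case False
      obtain u where "sublinear u" "\<And>q. q \<in> C \<Longrightarrow> u \<le> q"
        using sublinear_Inf_chain[OF False _ C(2), of p] C(1) by (auto simp: S_def)
      moreover from this False C(1) have "u \<le> p"
        unfolding S_def by (metis (no_types, lifting) all_not_in_conv mem_Collect_eq order_trans subsetD)
      ultimately show ?thesis by (auto simp: S_def)
    qed
  qed
  then obtain f where f: "sublinear f" "f \<le> p"
    and min: "\<And>q. sublinear q \<Longrightarrow> q \<le> f \<Longrightarrow> q = f"
    unfolding S_def by (metis (no_types, lifting) mem_Collect_eq order_trans)
  have add: "f (x + y) = f x + f y" for x y
  proof -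
    obtain q where q: "sublinear q" "\<And>x t. t \<ge> 0 \<Longrightarrow> q x \<le> f (x + t *\<^sub>R y) - t * f y"
      using sublinear_tilt[OF f(1)] by blast
    \<comment> \<open>The tilt bound at \<open>t = 0\<close> reads \<open>q x \<le> f x\<close>, so
      minimality applies. At \<open>t = 1\<close> it then becomes superadditivity of
      \<open>f\<close>.\<close>
    have "q = f"
      using q(2)[of 0] by (intro min q(1)) (simp add: le_fun_def)
    with q(2)[of 1 x] sublinear_add[OF f(1), of x y] show ?thesis by simp
  qed
  have minus: "f (- x) = - f x" for x
    using add[of x "- x"] by (simp add: sublinear_zero[OF f(1)])
  have "linear f"
  proof (rule linearI)
    fix t x
    show "f (t *\<^sub>R x) = t *\<^sub>R f x"
    proof (cases "t \<ge> 0")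
      case False
      then have "f ((- t) *\<^sub>R x) = (- t) * f x"
        by (intro sublinear_scaleR[OF f(1)]) simp
      then show ?thesis by (simp add: minus)
    qed (simp add: sublinear_scaleR[OF f(1)])
  qed (rule add)
  with f(2) show ?thesis by (intro that) (auto simp: le_fun_def)
qed

lemma norming_functional_real:
  fixes a :: "'e::real_normed_vector"
  obtains f :: "'e \<Rightarrow> real" where "linear f" "\<And>x. \<bar>f x\<bar> \<le> norm x" "f a = norm a"
proof -
  have "sublinear (norm :: 'e \<Rightarrow> real)"
    by (rule sublinearI) (auto intro: norm_triangle_ineq)
  then obtain q where q: "sublinear q" "\<And>x t. t \<ge> 0 \<Longrightarrow> q x \<le> norm (x + t *\<^sub>R a) - t * norm a"
    by (rule sublinear_tilt[where y = a]) blast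
  obtain f where f: "linear f" "\<And>x. f x \<le> q x"
    using linear_minorant[OF q(1)] by blast
  have le: "f x \<le> norm x" for x
    using f(2)[of x] q(2)[of 0 x] by simp
  \<comment> \<open>At \<open>- a\<close> with \<open>t = 1\<close> the tilted norm is at most
    \<open>norm (- a + a) - norm a\<close>.\<close>
  have "f (- a) \<le> - norm a"
    using f(2)[of "- a"] q(2)[of 1 "- a"] by simp
  then have "f a = norm a"
    using le[of a] by (simp add: linear_neg[OF f(1)])
  moreover have "\<bar>f x\<bar> \<le> norm x" for x
    using le[of x] le[of "- x"] by (simp add: linear_neg[OF f(1)])
  ultimately show ?thesis
    using f(1) by (intro that)
qed

text \<open>A real functional \<open>f\<close> is the real part of exactly one complex linear
  functional, namely \<open>F\<close>. Since \<open>f a = norm a\<close>, the modulus of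
  \<open>F a\<close> is at least \<open>norm a\<close>.\<close>

lemma norming_functional_complex:
  fixes s :: "complex \<Rightarrow> 'e::banach \<Rightarrow> 'e" and a :: 'e
  assumes s: "banach_over s"
  obtains F where "Vector_Spaces.linear s (*) F" "\<And>x. norm (F x) \<le> norm x" "norm (F a) \<ge> norm a"
proof -
  interpret vector_space s using s by (simp add: banach_over_def)
  have s_norm: "norm (s c x) = norm c * norm x" for c x
    using s by (simp add: banach_over_def)
  obtain f :: "'e \<Rightarrow> real" where f: "linear f" "\<And>x. \<bar>f x\<bar> \<le> norm x" "f a = norm a"
    using norming_functional_real[of a] by blast
  have s_real: "s (complex_of_real r) x = r *\<^sub>R x" for r x
    by (rule banach_over_of_real[OF s])
  define F where "F x = Complex (f x) (- f (s \<i> x))" for x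
  have F_add: "F (x + y) = F x + F y" for x y
    by (simp add: F_def complex_eq_iff linear_add[OF f(1)] scale_right_distrib)
  have F_i: "F (s \<i> x) = \<i> * F x" for x
    using s_real[of "- 1" x] by (simp add: F_def complex_eq_iff linear_neg[OF f(1)])
  have F_real: "F (s (of_real r) x) = of_real r * F x" for r x
  proof -
    have "s \<i> (r *\<^sub>R x) = r *\<^sub>R s \<i> x"
      by (simp flip: s_real add: mult.commute)
    then show ?thesis
      by (simp add: F_def complex_eq_iff s_real linear_scale[OF f(1)])
  qed
  have F_scale: "F (s c x) = c * F x" for c x
  proof -
    have "s c x = s (of_real (Re c)) x + s \<i> (s (of_real (Im c)) x)"
      by (simp flip: scale_left_distrib complex_eq)
    then have "F (s c x) = (of_real (Re c) + \<i> * of_real (Im c)) * F x"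
      by (simp add: F_add F_i F_real distrib_right mult.assoc del: scale_scale)
    then show ?thesis by (simp flip: complex_eq)
  qed
  have "norm (F x) \<le> norm x" for x
  proof (cases "F x = 0")
    case False
    \<comment> \<open>The unimodular factor \<open>c\<close> rotates \<open>F x\<close> onto the
      nonnegative real axis, where \<open>F\<close> agrees with \<open>f\<close> and inherits its
      bound.\<close>
    define c where "c = cnj (sgn (F x))"
    have c: "norm c = 1" using False by (simp add: c_def norm_sgn)
    have "c * F x = of_real (norm (F x))"
      using False by (simp add: c_def sgn_eq complex_norm_square[symmetric] power2_eq_square field_simps)
    then have "norm (F x) = Re (F (s c x))"
      by (simp add: F_scale)
    also have "\<dots> = f (s c x)" by (simp add: F_def)
    also have "\<dots> \<le> norm (s c x)" using f(2)[of "s c x"] by simp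
    finally show ?thesis by (simp add: s_norm c)
  qed simp
  moreover have "norm (F a) \<ge> norm a"
    using abs_Re_le_cmod[of "F a"] f(3) by (simp add: F_def)
  moreover have "Vector_Spaces.linear s (*) F"
    unfolding Vector_Spaces.linear_iff using F_add F_scale
    by (auto intro: vector_space_axioms simp: vector_space_def algebra_simps)
  ultimately show ?thesis by (intro that)
qed

section \<open>Homogeneity of the sup norm, and convergence along sets of indices\<close>

lemma norm_linf_scale: "norm (linf_scale a x) = norm a * norm x"
proof (rule antisym)
  have le: "norm (linf_scale a x) \<le> norm a * norm x" for a :: 'a and x
    by (rule norm_bound) (auto simp: norm_mult intro!: mult_left_mono norm_bounded)
  show "norm (linf_scale a x) \<le> norm a * norm x" by (rule le)
  show "norm a * norm x \<le> norm (linf_scale a x)"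
  proof (cases "a = 0")
    case False
    then show ?thesis
      using mult_left_mono[OF le[of "inverse a" "linf_scale a x"], of "norm a"]
      by (simp add: nonzero_norm_inverse flip: mult.assoc)
  qed simp
qed

text \<open>For infinite \<open>A\<close> this filter expresses convergence of the subsequence
  indexed by \<open>A\<close> without enumerating \<open>A\<close>. Passing to a subset of indices
  is monotonicity of the filter.\<close>

abbreviation along :: "nat set \<Rightarrow> nat filter" where
  "along A \<equiv> inf sequentially (principal A)"

lemma along_nontrivial: "infinite A \<Longrightarrow> along A \<noteq> bot"
  by (auto simp: trivial_limit_def eventually_inf_principal eventually_sequentially infinite_nat_iff_unbounded_le)

lemma along_mono: "A \<subseteq> B \<Longrightarrow> along A \<le> along B"
  by (rule inf_mono) auto

lemma tendsto_alongI: "f \<longlonglongrightarrow> l \<Longrightarrow> (f \<longlongrightarrow> l) (along A)"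
  by (rule tendsto_mono[OF inf_le1])

text \<open>Divergence keeps \<open>x\<close> at distance at least \<open>e\<close> from
  \<open>l\<close> at infinitely many indices, and only finitely many of them lie in
  \<open>A\<close>. Adding infinitely many of the others destroys convergence: the part
  \<open>A\<close> forces the limit to be \<open>l\<close>, the new part excludes it.\<close>

lemma divergent_along_coinfinite_extension:
  fixes x :: "nat \<Rightarrow> 'k::real_normed_vector"
  assumes A: "infinite A" and lim: "(x \<longlongrightarrow> l) (along A)" and x: "\<not> convergent x"
  obtains A' where "A \<subseteq> A'" "infinite (- A')" "\<And>m. \<not> (x \<longlongrightarrow> m) (along A')"
proof -
  obtain e where e: "e > 0" and "\<not> (\<forall>\<^sub>F n in sequentially. dist (x n) l < e)"
    using x by (auto simp: convergent_def tendsto_iff)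
  then have "infinite {n. \<not> dist (x n) l < e}"
    by (simp flip: cofinite_eq_sequentially add: eventually_cofinite)
  moreover have "finite {n. \<not> (n \<in> A \<longrightarrow> dist (x n) l < e)}"
    using tendstoD[OF lim e]
    by (simp flip: cofinite_eq_sequentially add: eventually_inf_principal eventually_cofinite)
  ultimately have "infinite ({n. \<not> dist (x n) l < e} - {n. \<not> (n \<in> A \<longrightarrow> dist (x n) l < e)})"
    by (rule Diff_infinite_finite[rotated])
  moreover have "{n. \<not> dist (x n) l < e} - {n. \<not> (n \<in> A \<longrightarrow> dist (x n) l < e)}
      = {n. n \<notin> A \<and> \<not> dist (x n) l < e}"
    by auto
  ultimately have "infinite {n. n \<notin> A \<and> \<not> dist (x n) l < e}"
    by simp
  \<comment> \<open>Two disjoint infinite pieces are used: \<open>C 0\<close> is added to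
    \<open>A\<close>, and \<open>C 1\<close> stays outside to keep the complement infinite.\<close>
  then obtain C :: "nat \<Rightarrow> nat set" where disj: "pairwise (\<lambda>i j. disjnt (C i) (C j)) UNIV"
    and C: "(\<Union>i. C i) \<subseteq> {n. n \<notin> A \<and> \<not> dist (x n) l < e}" "\<And>i. infinite (C i)"
    by (rule infinite_infinite_partition) blast
  show ?thesis
  proof
    show "A \<subseteq> A \<union> C 0" by simp
    have "C 1 \<subseteq> - (A \<union> C 0)"
      using C(1) disj by (fastforce simp: pairwise_def disjnt_def)
    then show "infinite (- (A \<union> C 0))"
      using C(2) infinite_super by blast
    show "\<not> (x \<longlongrightarrow> m) (along (A \<union> C 0))" for m
    proof
      assume m: "(x \<longlongrightarrow> m) (along (A \<union> C 0))"
      have "(x \<longlongrightarrow> m) (along A)"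
        by (rule tendsto_mono[OF along_mono m]) simp
      then have "m = l"
        using lim along_nontrivial[OF A] tendsto_unique by blast
      moreover have "(x \<longlongrightarrow> m) (along (C 0))"
        by (rule tendsto_mono[OF along_mono m]) simp
      ultimately have "\<forall>\<^sub>F n in along (C 0). dist (x n) l < e"
        using e tendstoD by blast
      moreover have "\<forall>\<^sub>F n in along (C 0). \<not> dist (x n) l < e"
        unfolding eventually_inf_principal using C(1) by (intro always_eventually) blast
      ultimately have "\<forall>\<^sub>F n in along (C 0). False"
        by eventually_elim simp
      then show False
        using along_nontrivial[OF C(2)] by (simp add: trivial_limit_def)
    qed
  qed
qed

text \<open>A new generator raises the dimension by at most one, so the vectors that converge along
  the old \<open>A\<close> form at most a line. One extension of \<open>A\<close> makes its
  direction \<open>d\<close> diverge, and enlarging \<open>A\<close> creates no new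
  convergence.\<close>

lemma finite_dim_divergent_along_coinfinite:
  fixes B :: "'k::real_normed_field linf set"
  assumes "finite B" "linf.span B \<inter> c_space = {0}"
  obtains A where "infinite A" "infinite (- A)"
    "\<And>d l. d \<in> linf.span B \<Longrightarrow> (apply_bcontfun d \<longlongrightarrow> l) (along A) \<Longrightarrow> d = 0"
proof -
  have "\<exists>A. infinite A \<and> infinite (- A) \<and>
      (\<forall>d\<in>linf.span B. (\<exists>l. (apply_bcontfun d \<longlongrightarrow> l) (along A)) \<longrightarrow> d = 0)"
    using assms
  proof (induction B)
    case empty
    obtain C :: "nat \<Rightarrow> nat set" where C: "disjnt (C 0) (C 1)" "\<And>i. infinite (C i)"
      using infinite_infinite_partition[of "UNIV :: nat set"] by (metis infinite_UNIV_nat pairwiseD UNIV_I zero_neq_one)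
    have "C 1 \<subseteq> - C 0" using C(1) by (auto simp: disjnt_def)
    with C(2) have "infinite (- C 0)" using infinite_super by blast
    with C(2) show ?case by (intro exI[of _ "C 0"]) auto
  next
    case (insert b B)
    have "linf.span B \<subseteq> linf.span (insert b B)"
      by (intro linf.span_mono) auto
    then have "linf.span B \<inter> c_space = {0}"
      using insert.prems linf.span_zero[of B] by blast
    then obtain A where A: "infinite A" "infinite (- A)"
      and div: "\<And>d l. d \<in> linf.span B \<Longrightarrow> (apply_bcontfun d \<longlongrightarrow> l) (along A) \<Longrightarrow> d = 0"
      using insert.IH by blast
    show ?case
    proof (cases "\<exists>d\<in>linf.span (insert b B). d \<noteq> 0 \<and> (\<exists>l. (apply_bcontfun d \<longlongrightarrow> l) (along A))")
      case False
      with A show ?thesis by blast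
    next
      case True
      then obtain d l where d: "d \<in> linf.span (insert b B)" "d \<noteq> 0"
        and dl: "(apply_bcontfun d \<longlongrightarrow> l) (along A)" by blast
      obtain k where k: "d - linf_scale k b \<in> linf.span B"
        using d(1) by (auto simp: linf.span_insert)
      \<comment> \<open>Otherwise \<open>d\<close> would be a nonzero vector of
        \<open>linf.span B\<close> converging along \<open>A\<close>.\<close>
      have "k \<noteq> 0"
        using div[OF _ dl] d(2) k by auto
      have multiple: "\<exists>c. d' = linf_scale c d"
        if d': "d' \<in> linf.span (insert b B)" "(apply_bcontfun d' \<longlongrightarrow> l') (along A)" for d' l'
      proof -
        obtain k' where k': "d' - linf_scale k' b \<in> linf.span B"
          using d'(1) by (auto simp: linf.span_insert)
        \<comment> \<open>Subtracting the multiple of \<open>d\<close> with the same coefficient of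
          \<open>b\<close> leaves a vector of \<open>linf.span B\<close> that still converges along
          \<open>A\<close>, hence zero.\<close>
        have "(d' - linf_scale k' b) - linf_scale (k' / k) (d - linf_scale k b) \<in> linf.span B"
          by (intro linf.span_diff linf.span_scale k k')
        also have "(d' - linf_scale k' b) - linf_scale (k' / k) (d - linf_scale k b)
            = d' - linf_scale (k' / k) d"
          using \<open>k \<noteq> 0\<close> by (simp add: linf.scale_right_diff_distrib)
        finally have "d' - linf_scale (k' / k) d \<in> linf.span B" .
        moreover have "(apply_bcontfun (d' - linf_scale (k' / k) d) \<longlongrightarrow> l' - (k' / k) * l) (along A)"
          using tendsto_diff[OF d'(2) tendsto_mult_left[OF dl, of "k' / k"]] by simp
        ultimately show ?thesis using div by force
      qed
      have "\<not> convergent (apply_bcontfun d)"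
        using d insert.prems by (auto simp: c_space_def)
      then obtain A' where A': "A \<subseteq> A'" "infinite (- A')"
        and ndiv: "\<And>m. \<not> (apply_bcontfun d \<longlongrightarrow> m) (along A')"
        using divergent_along_coinfinite_extension[OF A(1) dl] by metis
      have "d' = 0"
        if d': "d' \<in> linf.span (insert b B)" "(apply_bcontfun d' \<longlongrightarrow> l') (along A')" for d' l'
      proof (rule ccontr)
        assume "d' \<noteq> 0"
        have "(apply_bcontfun d' \<longlongrightarrow> l') (along A)"
          by (rule tendsto_mono[OF along_mono[OF A'(1)] d'(2)])
        then obtain c where c: "d' = linf_scale c d"
          using multiple d'(1) by blast
        with \<open>d' \<noteq> 0\<close> have "c \<noteq> 0" by auto
        then have "(apply_bcontfun d \<longlongrightarrow> inverse c * l') (along A')"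
          using tendsto_mult_left[OF d'(2), of "inverse c"] c by (simp flip: mult.assoc)
        with ndiv show False by blast
      qed
      with A' A(1) show ?thesis
        by (meson infinite_super)
    qed
  qed
  with that show ?thesis by blast
qed

section \<open>Closedness of finite-dimensional extensions and of isometric images\<close>

lemma closed_span_insert:
  fixes M :: "'k::{real_normed_field,banach} linf set"
  assumes M: "linf.subspace M" "closed M"
  shows "closed (linf.span (insert b M))"
proof (cases "b \<in> M")
  case True
  with M show ?thesis by (simp add: insert_absorb linf.span_eq_iff[THEN iffD2])
next
  case False
  have span: "linf.span (insert b M) = {y. \<exists>k. y - linf_scale k b \<in> M}"
    using M(1) by (simp add: linf.span_insert linf.span_eq_iff[THEN iffD2])
  obtain e where e: "e > 0" "\<And>v. v \<in> M \<Longrightarrow> e \<le> norm (b - v)"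
  proof -
    obtain e where "e > 0" "ball b e \<subseteq> - M"
      using False M(2) by (metis open_Compl openE Compl_iff)
    then show ?thesis
      by (intro that[of e]) (auto simp: subset_eq dist_norm not_less[symmetric])
  qed
  \<comment> \<open>Since \<open>b\<close> has distance at least \<open>e\<close> from
    \<open>M\<close>, the coefficient of \<open>b\<close> is a Lipschitz function of the
    vector.\<close>
  have lower: "norm k * e \<le> norm (v + linf_scale k b)" if "v \<in> M" for k v
  proof (cases "k = 0")
    case False
    have "e \<le> norm (b - linf_scale (- inverse k) v)"
      by (intro e linf.subspace_scale[OF M(1)] that)
    then have "norm k * e \<le> norm k * norm (b - linf_scale (- inverse k) v)"
      by (intro mult_left_mono) auto
    also have "\<dots> = norm (linf_scale k (b - linf_scale (- inverse k) v))"
      by (simp add: norm_linf_scale)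
    also have "linf_scale k (b - linf_scale (- inverse k) v) = v + linf_scale k b"
      using False by (simp add: linf.scale_right_distrib)
    finally show ?thesis .
  qed simp
  show ?thesis
    unfolding closed_sequential_limits
  proof (intro allI impI, elim conjE)
    fix y l assume "\<forall>n. y n \<in> linf.span (insert b M)" and l: "y \<longlonglongrightarrow> l"
    then have "\<forall>n. \<exists>k. y n - linf_scale k b \<in> M"
      by (simp add: span)
    from choice[OF this] obtain k where k: "\<And>n. y n - linf_scale (k n) b \<in> M"
      by blast
    have kle: "norm (k m - k n) * e \<le> norm (y m - y n)" for m n
      using lower[OF linf.subspace_diff[OF M(1) k[of m] k[of n]], of "k m - k n"]
      by (simp add: linf.scale_left_diff_distrib)
    \<comment> \<open>The coefficients therefore converge in the complete scalar field. Subtracting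
      their multiples of \<open>b\<close> leaves a convergent sequence in the closed set
      \<open>M\<close>.\<close>
    have "Cauchy k"
    proof (rule CauchyI)
      fix r :: real assume "r > 0"
      then have "r * e > 0" using e by simp
      then obtain N where "\<And>m n. m \<ge> N \<Longrightarrow> n \<ge> N \<Longrightarrow> norm (y m - y n) < r * e"
        using CauchyD[OF LIMSEQ_imp_Cauchy[OF l]] by blast
      then have "norm (k m - k n) < r" if "m \<ge> N" "n \<ge> N" for m n
        using le_less_trans[OF kle[of m n], of "r * e"] e(1) that by simp
      then show "\<exists>N. \<forall>m\<ge>N. \<forall>n\<ge>N. norm (k m - k n) < r" by blast
    qed
    then obtain c where c: "k \<longlonglongrightarrow> c"
      using Cauchy_convergent convergent_def by blast
    have "(\<lambda>n. norm (k n - c) * norm b) \<longlonglongrightarrow> 0 * norm b"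
      using c by (intro tendsto_mult tendsto_const) (simp add: tendsto_norm_zero_iff LIM_zero_iff)
    then have "(\<lambda>n. linf_scale (k n) b - linf_scale c b) \<longlonglongrightarrow> 0"
      by (subst tendsto_norm_zero_iff[symmetric])
         (simp add: norm_linf_scale flip: linf.scale_left_diff_distrib)
    then have "(\<lambda>n. linf_scale (k n) b) \<longlonglongrightarrow> linf_scale c b"
      by (simp add: LIM_zero_iff)
    then have "(\<lambda>n. y n - linf_scale (k n) b) \<longlonglongrightarrow> l - linf_scale c b"
      by (intro tendsto_diff l)
    with k M(2) have "l - linf_scale c b \<in> M"
      by (meson closed_sequentially)
    then show "l \<in> linf.span (insert b M)"
      by (auto simp: span)
  qed
qed

lemma closed_span_finite_Un:
  fixes M :: "'k::{real_normed_field,banach} linf set"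
  assumes "finite B" "linf.subspace M" "closed M"
  shows "closed (linf.span (B \<union> M))"
  using assms(1)
proof induction
  case empty
  then show ?case using assms(2,3) by (simp add: linf.span_eq_iff[THEN iffD2])
next
  case (insert b B)
  have "linf.span (insert b (linf.span (B \<union> M))) = linf.span (insert b B \<union> M)"
    by (simp add: linf.span_insert linf.span_span)
  with closed_span_insert[OF linf.subspace_span insert.IH, of b] show ?case by simp
qed

text \<open>Preimages of a convergent sequence in the range are Cauchy, so completeness of
  \<open>'e\<close> provides a preimage of the limit.\<close>

lemma closed_range_isometry:
  fixes T :: "'e::banach \<Rightarrow> 'k::real_normed_field linf"
  assumes "\<And>x y. T (x - y) = T x - T y" "\<And>x. norm (T x) = norm x"
  shows "closed (range T)"
proof -
  have dist: "dist (T x) (T y) = dist x y" for x y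
    by (simp add: dist_norm assms flip: assms(1))
  show ?thesis
    unfolding closed_sequential_limits
  proof (intro allI impI, elim conjE)
    fix y l assume "\<forall>n. y n \<in> range T" and l: "y \<longlonglongrightarrow> l"
    then have "\<forall>n. \<exists>x. y n = T x" by auto
    from choice[OF this] obtain x where x: "y = (\<lambda>n. T (x n))" by blast
    have "Cauchy x"
      using LIMSEQ_imp_Cauchy[OF l] by (simp add: x Cauchy_def dist)
    then obtain a where a: "x \<longlonglongrightarrow> a"
      using Cauchy_convergent convergent_def by blast
    then have "y \<longlonglongrightarrow> T a"
      by (simp add: tendsto_iff x dist)
    with l show "l \<in> range T"
      using LIMSEQ_unique by blast
  qed
qed

section \<open>The embedding off \<open>A\<close> and the space \<open>Z\<close>\<close>

lemma dense_sequence: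
  assumes "separable_space (euclidean :: 'e::metric_space topology)"
  obtains u :: "nat \<Rightarrow> 'e::metric_space" where "\<And>x e. e > 0 \<Longrightarrow> \<exists>k. dist (u k) x < e"
proof -
  obtain U :: "'e set" where U: "countable U" "closure U = UNIV"
    using assms by (auto simp: separable_space_def)
  have "U \<noteq> {}" using U(2) by auto
  show ?thesis
  proof
    fix x and e :: real assume "e > 0"
    then obtain y where "y \<in> U" "dist y x < e"
      using U(2) closure_approachable[of x U] by auto
    then show "\<exists>k. dist (from_nat_into U k) x < e"
      using from_nat_into_surj[OF U(1)] by metis
  qed
qed

text \<open>Treats both scalar fields at once; \<open>norming\<close> isolates the Hahn-Banach
  input, which is proved separately for each.\<close>

lemma disjoint_from_c_extension:
  fixes s :: "'k::{real_normed_field,banach} \<Rightarrow> 'e::banach \<Rightarrow> 'e"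
  assumes D: "finite_dim_subspace D" "D \<inter> c_space = {0}"
    and sep: "separable_space (euclidean :: 'e topology)"
    and norming: "\<And>a. \<exists>F. Vector_Spaces.linear s (*) F \<and> (\<forall>x. norm (F x) \<le> norm x) \<and> norm (F a) \<ge> norm a"
  shows "\<exists>Z. linf.subspace Z \<and> closed Z \<and> D \<subseteq> Z \<and>
             (\<exists>Y. linf.subspace Y \<and> Y \<subseteq> Z \<and> isometric_to Y s) \<and>
             Z \<inter> c_space = {0}"
proof -
  obtain B where B: "finite B" "D = linf.span B"
    using D(1) by (auto simp: finite_dim_subspace_def)
  obtain A where A: "infinite A" "infinite (- A)"
    and div: "\<And>d l. d \<in> D \<Longrightarrow> (apply_bcontfun d \<longlongrightarrow> l) (along A) \<Longrightarrow> d = 0"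
    using finite_dim_divergent_along_coinfinite[OF B(1)] D(2) B(2) by metis
  \<comment> \<open>Each functional \<open>F k\<close> receives its own infinite block
    \<open>C k\<close> off \<open>A\<close>, so that its value recurs infinitely often.\<close>
  obtain C :: "nat \<Rightarrow> nat set" where disj: "pairwise (\<lambda>i j. disjnt (C i) (C j)) UNIV"
    and C: "(\<Union>i. C i) \<subseteq> - A" "\<And>i. infinite (C i)"
    by (rule infinite_infinite_partition[OF A(2)]) blast
  obtain u :: "nat \<Rightarrow> 'e" where u: "\<And>x e. e > 0 \<Longrightarrow> \<exists>k. dist (u k) x < e"
    using dense_sequence[OF sep] by blast
  have "\<forall>k. \<exists>F. Vector_Spaces.linear s (*) F \<and> (\<forall>x. norm (F x) \<le> norm x) \<and> norm (F (u k)) \<ge> norm (u k)"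
    using norming by blast
  then obtain F where F_linear: "\<And>k. Vector_Spaces.linear s (*) (F k)"
    and F_le: "\<And>k x. norm (F k x) \<le> norm x" and F_ge: "\<And>k. norm (F k (u k)) \<ge> norm (u k)"
    by metis
  interpret F: Vector_Spaces.linear s "(*)" "F k" for k
    by (rule F_linear)
  \<comment> \<open>Off \<open>A\<close> and all blocks, \<open>h n\<close> is some unspecified
    index. This is harmless: \<open>F (h n)\<close> is linear and bounded by the norm for every
    index.\<close>
  define h where "h n = (THE k. n \<in> C k)" for n
  have h: "h n = k" if "n \<in> C k" for n k
    unfolding h_def
  proof (rule the_equality)
    show "n \<in> C k" by (rule that)
    show "j = k" if "n \<in> C j" for j
      using disj that \<open>n \<in> C k\<close> by (auto simp: pairwise_def disjnt_def)
  qed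
  define t where "t x n = (if n \<in> A then 0 else F (h n) x)" for x n
  have t_le: "norm (t x n) \<le> norm x" for x n
    by (simp add: t_def F_le)
  define T where "T x = Bcontfun (t x)" for x
  have T: "apply_bcontfun (T x) = t x" for x
    unfolding T_def using t_le by (intro Bcontfun_inverse bcontfun_normI) auto
  have T_C: "t x n = F k x" if "n \<in> C k" for x n k
    using that C(1) by (auto simp: t_def h)
  have T_linear: "Vector_Spaces.linear s linf_scale T"
    unfolding Vector_Spaces.linear_iff
    by (auto intro!: bcontfun_eqI F.vs1.vector_space_axioms linf.vector_space_axioms
        simp: T t_def F.add F.scale)
  interpret T: Vector_Spaces.linear s linf_scale T by (rule T_linear)
  \<comment> \<open>\<open>F k\<close> is known to norm only \<open>u k\<close>. Moving from
    \<open>u k\<close> to \<open>x\<close> costs \<open>dist (u k) x\<close> twice, hence the choice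
    of \<open>e / 2\<close>.\<close>
  have F_norm: "norm x \<le> b" if b: "\<And>k. norm (F k x) \<le> b" for x b
  proof (rule field_le_epsilon)
    fix e :: real assume "e > 0"
    then obtain k where k: "dist (u k) x < e / 2"
      using u[of "e / 2" x] by auto
    have "norm (F k (u k)) \<le> norm (F k x) + norm (F k (u k - x))"
      using norm_triangle_ineq[of "F k x" "F k (u k - x)"] by (simp add: F.diff)
    also have "\<dots> \<le> b + dist (u k) x"
      using b F_le[of k "u k - x"] by (simp add: dist_norm add_mono)
    finally have "norm (u k) \<le> b + dist (u k) x"
      using F_ge[of k] by linarith
    moreover have "norm x \<le> norm (u k) + dist (u k) x"
      using norm_triangle_ineq2[of x "u k"] by (simp add: dist_norm norm_minus_commute)
    ultimately show "norm x \<le> b + e" using k by simp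
  qed
  have T_norm: "norm (T x) = norm x" for x
  proof (rule antisym)
    show "norm (T x) \<le> norm x"
      by (rule norm_bound) (simp add: T t_le)
    show "norm x \<le> norm (T x)"
    proof (rule F_norm)
      fix k
      obtain n where "n \<in> C k" using C(2) by (metis ex_in_conv finite.emptyI)
      then show "norm (F k x) \<le> norm (T x)"
        using norm_bounded[of "T x" n] by (simp add: T T_C)
    qed
  qed
  have Y: "linf.subspace (range T)"
    by (intro T.subspace_image F.vs1.subspace_UNIV)
  define Z where "Z = linf.span (B \<union> range T)"
  have "z = 0" if "z \<in> Z" "z \<in> c_space" for z
  proof -
    obtain d x where d: "d \<in> D" and z: "z = d + T x"
      using \<open>z \<in> Z\<close> Y by (auto simp: Z_def linf.span_Un B(2) linf.span_eq_iff[THEN iffD2])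
    obtain l where l: "apply_bcontfun z \<longlonglongrightarrow> l"
      using \<open>z \<in> c_space\<close> by (auto simp: c_space_def convergent_def)
    \<comment> \<open>\<open>T x\<close> vanishes on \<open>A\<close>, so \<open>z\<close> and
      \<open>d\<close> agree there.\<close>
    have "(apply_bcontfun d \<longlongrightarrow> l) (along A)"
    proof (rule Lim_transform_eventually[OF tendsto_alongI[OF l]])
      show "\<forall>\<^sub>F n in along A. apply_bcontfun z n = apply_bcontfun d n"
        by (auto simp: eventually_inf_principal z T t_def)
    qed
    then have "d = 0" by (rule div[OF d])
    then have tl: "t x \<longlonglongrightarrow> l" using l by (simp add: z T)
    \<comment> \<open>The limit can be read off any infinite set on which \<open>t x\<close> is
      constant: \<open>A\<close> gives 0 and \<open>C k\<close> gives \<open>F k x\<close>.\<close>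
    have lim_eq: "l = c" if "infinite S" "\<And>n. n \<in> S \<Longrightarrow> t x n = c" for S c
    proof -
      have "(t x \<longlongrightarrow> c) (along S)"
        by (rule tendsto_eventually) (simp add: eventually_inf_principal that(2))
      with tendsto_alongI[OF tl] show ?thesis
        using tendsto_unique along_nontrivial[OF that(1)] by blast
    qed
    have "l = 0" by (rule lim_eq[OF A(1)]) (simp add: t_def)
    then have "F k x = 0" for k
      using lim_eq[OF C(2), of k "F k x"] T_C by simp
    then have "norm x \<le> 0" by (intro F_norm) simp
    then show "z = 0" by (simp add: z \<open>d = 0\<close>)
  qed
  moreover have "0 \<in> Z" "(0 :: 'k linf) \<in> c_space"
    using linf.span_zero D(2) by (auto simp: Z_def)
  ultimately have "Z \<inter> c_space = {0}" by blast
  moreover have "closed Z"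
    unfolding Z_def
    by (intro closed_span_finite_Un B(1) Y closed_range_isometry T.diff T_norm)
  moreover have "D \<subseteq> Z"
    unfolding B(2) Z_def by (intro linf.span_mono) auto
  moreover have "range T \<subseteq> Z"
    unfolding Z_def using linf.span_superset[of "B \<union> range T"] by (rule le_supE)
  moreover have "isometric_to (range T) s"
    unfolding isometric_to_def using T_linear T_norm by blast
  moreover have "linf.subspace Z"
    unfolding Z_def by (rule linf.subspace_span)
  ultimately show ?thesis
    using Y by (intro exI[of _ Z] conjI exI[of _ "range T"])
qed

theorem theorem2p2:
  shows
    "(\<forall>D :: real linf set.
        finite_dim_subspace D \<and> D \<inter> c_space = {0} \<and>
        separable_space (euclidean :: 'e::banach topology) \<longrightarrow>
        (\<exists>Z. linf.subspace Z \<and> closed Z \<and> D \<subseteq> Z \<and>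
             (\<exists>Y. linf.subspace Y \<and> Y \<subseteq> Z \<and> isometric_to Y (scaleR :: real \<Rightarrow> 'e \<Rightarrow> 'e)) \<and>
             Z \<inter> c_space = {0}))
     \<and>
     (\<forall>(D :: complex linf set) (s :: complex \<Rightarrow> 'f::banach \<Rightarrow> 'f).
        finite_dim_subspace D \<and> D \<inter> c_space = {0} \<and>
        banach_over s \<and> separable_space (euclidean :: 'f topology) \<longrightarrow>
        (\<exists>Z. linf.subspace Z \<and> closed Z \<and> D \<subseteq> Z \<and>
             (\<exists>Y. linf.subspace Y \<and> Y \<subseteq> Z \<and> isometric_to Y s) \<and>
             Z \<inter> c_space = {0}))"
proof (intro conjI allI impI)
  fix D :: "real linf set"
  assume D: "finite_dim_subspace D \<and> D \<inter> c_space = {0} \<and>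
    separable_space (euclidean :: 'e topology)"
  have "\<exists>F. Vector_Spaces.linear scaleR (*) F \<and> (\<forall>x. norm (F x) \<le> norm x) \<and> norm (F a) \<ge> norm a"
    for a :: 'e
  proof -
    obtain f :: "'e \<Rightarrow> real" where "linear f" "\<And>x. \<bar>f x\<bar> \<le> norm x" "f a = norm a"
      using norming_functional_real[of a] by blast
    \<comment> \<open>On the reals \<open>scaleR\<close> is multiplication, so real linearity has
      the form required by \<open>norming\<close>.\<close>
    then show ?thesis
      by (intro exI[of _ f]) (auto simp: linear_def real_scaleR_def[abs_def])
  qed
  with D show "\<exists>Z. linf.subspace Z \<and> closed Z \<and> D \<subseteq> Z \<and>
      (\<exists>Y. linf.subspace Y \<and> Y \<subseteq> Z \<and> isometric_to Y (scaleR :: real \<Rightarrow> 'e \<Rightarrow> 'e)) \<and>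
      Z \<inter> c_space = {0}"
    by (intro disjoint_from_c_extension) auto
next
  fix D :: "complex linf set" and s :: "complex \<Rightarrow> 'f \<Rightarrow> 'f"
  assume D: "finite_dim_subspace D \<and> D \<inter> c_space = {0} \<and>
    banach_over s \<and> separable_space (euclidean :: 'f topology)"
  then have "\<exists>F. Vector_Spaces.linear s (*) F \<and> (\<forall>x. norm (F x) \<le> norm x) \<and> norm (F a) \<ge> norm a" for a
    using norming_functional_complex[of s a] by metis
  with D show "\<exists>Z. linf.subspace Z \<and> closed Z \<and> D \<subseteq> Z \<and>
      (\<exists>Y. linf.subspace Y \<and> Y \<subseteq> Z \<and> isometric_to Y s) \<and> Z \<inter> c_space = {0}"
    by (intro disjoint_from_c_extension) auto
qed

end
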